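(* For any integer $k$, the elliptic curve $E_k$ given by the Weierstrass equation $$Y^2 - kXY = X^3 - (k^2+5)$$ has no integral point.
   Context: An integral point of $E_k$ means an affine point with integer coordinates on the given Weierstrass equation, i.e. a pair $(X,Y) = (a,b) \in \mathbb{Z}^2$ with $b^2 - kab = a^3 - (k^2+5)$. *)

theory Defs
  imports Main
begin

record weierstrass_eqn =
  coeff_a1 :: int
  coeff_a2 :: int
  coeff_a3 :: int
  coeff_a4 :: int
  coeff_a6 :: int

definition integral_points :: "weierstrass_eqn \<Rightarrow> (int \<times> int) set" where
  "integral_points W = {(x, y).
     y\<^sup>2 + coeff_a1 W * x * y + coeff_a3 W * y
       = x^3 + coeff_a2 W * x\<^sup>2 + coeff_a4 W * x + coeff_a6 W}"

definition discriminant :: "weierstrass_eqn \<Rightarrow> int" where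
  "discriminant W =
    (let a1 = coeff_a1 W; a2 = coeff_a2 W; a3 = coeff_a3 W; a4 = coeff_a4 W; a6 = coeff_a6 W;
         b2 = a1\<^sup>2 + 4 * a2;
         b4 = 2 * a4 + a1 * a3;
         b6 = a3\<^sup>2 + 4 * a6;
         b8 = a1\<^sup>2 * a6 + 4 * a2 * a6 - a1 * a3 * a4 + a2 * a3\<^sup>2 - a4\<^sup>2
     in - (b2\<^sup>2) * b8 - 8 * b4^3 - 27 * b6\<^sup>2 + 9 * b2 * b4 * b6)"

text \<open>A Weierstrass equation defines an elliptic curve over the rationals iff it is nonsingular,
  that is, iff its discriminant does not vanish.\<close>

definition is_elliptic :: "weierstrass_eqn \<Rightarrow> bool" where
  "is_elliptic W \<longleftrightarrow> discriminant W \<noteq> 0"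

definition E :: "int \<Rightarrow> weierstrass_eqn" where
  "E k = \<lparr>coeff_a1 = - k, coeff_a2 = 0, coeff_a3 = 0, coeff_a4 = 0, coeff_a6 = - (k\<^sup>2 + 5)\<rparr>"

lemma integral_points_E_iff:
  "(a, b) \<in> integral_points (E k) \<longleftrightarrow> b\<^sup>2 - k * a * b = a^3 - (k\<^sup>2 + 5)"
  by (simp add: integral_points_def E_def algebra_simps)

lemma discriminant_E: "discriminant (E k) = (k\<^sup>2 + 5) * (k^6 - 432 * (k\<^sup>2 + 5))"
  by (simp add: discriminant_def E_def Let_def algebra_simps power_numeral_reduce)

lemma is_elliptic_E: "is_elliptic (E k)"
proof -
  define t where "t = \<bar>k\<bar>"
  have t0: "t \<ge> 0" and sq: "k\<^sup>2 = t\<^sup>2" by (simp_all add: t_def)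
  have k6: "k^6 = t\<^sup>2 * t\<^sup>2 * t\<^sup>2"
    unfolding sq[symmetric] by (simp flip: power_add)
  have "t\<^sup>2 * t\<^sup>2 * t\<^sup>2 \<noteq> 432 * (t\<^sup>2 + 5)"
  proof (cases "t \<le> 4")
    case True
    with t0 have "t \<in> {0, 1, 2, 3, 4}" by auto
    then show ?thesis by auto
  next
    case False
    then have "t\<^sup>2 \<ge> 25"
      using power_mono[of 5 t 2] by simp
    then have "t\<^sup>2 * t\<^sup>2 \<ge> 25 * 25"
      by (intro mult_mono) auto
    then have "t\<^sup>2 * t\<^sup>2 * t\<^sup>2 \<ge> 25 * 25 * t\<^sup>2"
      by (intro mult_right_mono) auto
    moreover have "25 * 25 * t\<^sup>2 > 432 * (t\<^sup>2 + 5)"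
      using \<open>t\<^sup>2 \<ge> 25\<close> by simp
    ultimately show ?thesis by linarith
  qed
  moreover have "k\<^sup>2 + 5 \<noteq> 0"
    using zero_le_power2[of k] by linarith
  ultimately show ?thesis
    by (simp add: is_elliptic_def discriminant_E k6 sq)
qed

end

theory Submission
  imports Defs "HOL-Computational_Algebra.Primes"
begin

text \<open>The equation reads \<open>b\<^sup>2 - a b k + k\<^sup>2 = a\<^sup>3 - 5\<close>. Working modulo 4 gives \<open>a \<equiv> 1 (mod 4)\<close>.
  Modulo \<open>a - 2\<close> the equation becomes \<open>(b - k)\<^sup>2 \<equiv> 3\<close>, and every divisor of \<open>x\<^sup>2 - 3\<close> that is
  prime to 6 is \<open>\<plusminus>1\<close> modulo 12. If 3 does not divide \<open>a - 2\<close>, this forces \<open>a \<equiv> 1 (mod 12)\<close>, and the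
  equation modulo 3 says that 2 is a square. If 3 divides \<open>a - 2\<close>, the same argument applied to
  \<open>(a - 2) / 3\<close> contradicts the equation modulo 9.\<close>

text \<open>As \<open>d\<close> is odd, adding \<open>d\<close> changes the parity. Reduction modulo
  \<open>2 * d\<close> keeps both the parity and the class modulo \<open>d\<close>, and an even
  remainder is never \<open>d\<close>, so the bound is strict.\<close>

lemma ex_even_residue:
  fixes d x :: int
  assumes "odd d" "d > 0"
  obtains y where "even y" "\<bar>y\<bar> < d" "d dvd y - x"
proof -
  define z where "z = (if even x then x else x + d)"
  have z: "even z" "d dvd z - x" using assms by (auto simp: z_def)
  define r where "r = z mod (2 * d)"
  have r: "0 \<le> r" "r < 2 * d" using assms by (simp_all add: r_def)
  have zr: "z = 2 * d * (z div (2 * d)) + r" by (simp add: r_def)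
  have er: "even r" using z(1) zr by (metis dvd_add_right_iff dvd_triv_left mult.assoc)
  have "r - x = (z - x) - d * (2 * (z div (2 * d)))" using zr by (simp add: algebra_simps)
  then have dr: "d dvd r - x" using z(2) by (simp only: dvd_diff dvd_triv_left)
  show thesis
  proof (cases "r < d")
    case True
    with that[of r] er r dr show thesis by simp
  next
    case False
    have "r \<noteq> d" using er assms by auto
    moreover have "d dvd (r - x) - 2 * d" using dr by (simp add: dvd_diff)
    then have "d dvd (r - 2 * d) - x" by (simp add: algebra_simps)
    ultimately show thesis using that[of "r - 2 * d"] er r False by simp
  qed
qed

text \<open>Multiplying by a unit \<plusminus>1 changes \<open>d\<close> only up to sign.\<close>

lemma mult_mod_12_eq_pm1:
  fixes d e :: int
  assumes "d * e mod 12 \<in> {1, 11}" "e mod 12 \<in> {1, 11}"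
  shows "d mod 12 \<in> {1, 11}"
proof -
  define X where "X = d * e"
  have "12 dvd e - 1 \<or> 12 dvd e + 1" using assms(2) by auto presburger+
  then have "12 dvd d * (e - 1) \<or> 12 dvd d * (e + 1)" by (auto intro: dvd_mult)
  then have "12 dvd X - d \<or> 12 dvd X + d" by (simp add: X_def algebra_simps)
  moreover have "X mod 12 = 1 \<or> X mod 12 = 11" using assms(1) by (simp add: X_def)
  ultimately have "d mod 12 = 1 \<or> d mod 12 = 11" by (elim disjE) presburger+
  then show ?thesis by simp
qed

lemma mult_mod_12_pm1_coprime_6:
  fixes d e :: int
  assumes "d * e mod 12 \<in> {1, 11}"
  shows "odd e" "\<not> 3 dvd e"
proof -
  have "\<not> p dvd e" if "p dvd 12" "\<not> p dvd 1" "\<not> p dvd 11" for p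
    using that assms dvd_mod[of p "d * e" 12] by auto
  from this[of 2] this[of 3] show "odd e" "\<not> 3 dvd e" by simp_all
qed

text \<open>Descent on the divisor: for even \<open>y \<equiv> x\<close> with \<open>\<bar>y\<bar> < \<bar>d\<bar>\<close>, the cofactor of \<open>d\<close> in
  \<open>y\<^sup>2 - 3\<close> (divided by 3 if \<open>3 dvd y\<close>) is a smaller divisor of the same kind.\<close>

lemma divisor_square_minus_3_mod_12:
  fixes d x :: int
  assumes "odd d" "\<not> 3 dvd d" "d dvd x\<^sup>2 - 3"
  shows "d mod 12 \<in> {1, 11}"
  using assms
proof (induction "nat \<bar>d\<bar>" arbitrary: d x rule: less_induct)
  case less
  show ?case
  proof (cases "\<bar>d\<bar> = 1")
    case True
    then have "d = 1 \<or> d = -1" by auto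
    then show ?thesis by auto
  next
    case False
    have "d \<noteq> 0" using less.prems by auto
    with False have d2: "\<bar>d\<bar> \<ge> 2" by auto
    obtain y where y: "even y" "\<bar>y\<bar> < \<bar>d\<bar>" "\<bar>d\<bar> dvd y - x"
      using ex_even_residue[of "\<bar>d\<bar>" x] less.prems d2 by auto
    have "y\<^sup>2 - 3 = (y - x) * (y + x) + (x\<^sup>2 - 3)"
      by (simp add: algebra_simps power2_eq_square)
    moreover have "d dvd (y - x) * (y + x)" using y(3) by simp
    ultimately have "d dvd y\<^sup>2 - 3" using less.prems(3) by (simp only: dvd_add)
    then obtain e where e: "y\<^sup>2 - 3 = d * e" by (auto elim: dvdE)
    \<comment> \<open>The bound \<open>\<bar>d\<bar> \<ge> 2\<close> handles the case of negative
      \<open>y\<^sup>2 - 3\<close>.\<close>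
    have "\<bar>y\<^sup>2 - 3\<bar> < \<bar>d\<bar>\<^sup>2"
    proof -
      have "y\<^sup>2 < \<bar>d\<bar>\<^sup>2" using y(2) by (metis abs_ge_zero power2_abs power_strict_mono zero_less_numeral)
      moreover have "\<bar>d\<bar>\<^sup>2 \<ge> 4" using power_mono[OF d2, of 2] by simp
      moreover have "y\<^sup>2 \<ge> 0" by simp
      ultimately show ?thesis by linarith
    qed
    then have "\<bar>d\<bar> * \<bar>e\<bar> < \<bar>d\<bar> * \<bar>d\<bar>" by (metis e abs_mult power2_eq_square)
    then have small: "\<bar>e\<bar> < \<bar>d\<bar>" by (rule mult_left_less_imp_less) simp
    obtain z where z: "y = 2 * z" using y(1) by (auto elim: evenE)
    show ?thesis
    proof (cases "3 dvd y")
      case False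
      \<comment> \<open>Here \<open>z\<^sup>2\<close> is 1 modulo 3, so
        \<open>4 * z\<^sup>2 - 3\<close> is 1 modulo 12.\<close>
      have "z mod 3 = 1 \<or> z mod 3 = 2" using False z by presburger
      then have "z\<^sup>2 mod 3 = 1" using power_mod[of z 3 2] by auto
      moreover have "d * e = 4 * z\<^sup>2 - 3" using e z by (simp add: power2_eq_square)
      ultimately have de: "d * e mod 12 = 1" by presburger
      then have "odd e" "\<not> 3 dvd e" using mult_mod_12_pm1_coprime_6[of d e] by auto
      then have "e mod 12 \<in> {1, 11}"
        using less.hyps[of e y] small e by simp
      then show ?thesis using mult_mod_12_eq_pm1[of d e] de by simp
    next
      case True
      then have "3 dvd z" using z by presburger
      then obtain w where w: "z = 3 * w" by (auto elim: dvdE)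
      have de: "d * e = 3 * (12 * w\<^sup>2 - 1)" using e z w by (simp add: power2_eq_square)
      have "3 dvd d * e" using de by simp
      then have "3 dvd e" using less.prems(2) prime_dvd_mult_iff[of "3 :: int" d e] by simp
      then obtain f where f: "e = 3 * f" by (auto elim: dvdE)
      \<comment> \<open>As 3 does not divide \<open>d\<close>, the factor 3 was cancelled from
        \<open>e\<close>; \<open>f\<close> now plays the role of the smaller divisor.\<close>
      have df: "d * f = 12 * w\<^sup>2 - 1" using de f by simp
      then have df12: "d * f mod 12 = 11" by presburger
      have "odd f" "\<not> 3 dvd f" using df12 mult_mod_12_pm1_coprime_6[of d f] by auto
      moreover have "f dvd y\<^sup>2 - 3" using e f by simp
      moreover have "\<bar>f\<bar> < \<bar>d\<bar>" using small f by simp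
      ultimately have "f mod 12 \<in> {1, 11}" using less.hyps[of f y] by simp
      then show ?thesis using mult_mod_12_eq_pm1[of d f] df12 by simp
    qed
  qed
qed

lemma E_no_integral_solution:
  fixes a b k :: int
  shows "b\<^sup>2 - k * a * b \<noteq> a^3 - (k\<^sup>2 + 5)"
proof
  assume eq: "b\<^sup>2 - k * a * b = a^3 - (k\<^sup>2 + 5)"
  have a4: "a mod 4 = 1"
  proof -
    have "((b mod 4)\<^sup>2 - k mod 4 * (a mod 4) * (b mod 4)) mod 4 = (b\<^sup>2 - k * a * b) mod 4"
      by (intro mod_diff_cong mod_mult_cong power_mod mod_mod_trivial)
    moreover have "((a mod 4)^3 - ((k mod 4)\<^sup>2 + 5)) mod 4 = (a^3 - (k\<^sup>2 + 5)) mod 4"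
      by (intro mod_diff_cong mod_add_cong power_mod refl)
    ultimately have "((b mod 4)\<^sup>2 - k mod 4 * (a mod 4) * (b mod 4)) mod 4
        = ((a mod 4)^3 - ((k mod 4)\<^sup>2 + 5)) mod 4"
      using eq by simp
    moreover have "r mod 4 = 0 \<or> r mod 4 = 1 \<or> r mod 4 = 2 \<or> r mod 4 = 3" for r :: int
      by presburger
    note this[of a] this[of b] this[of k]
    ultimately show ?thesis by (elim disjE) simp_all
  qed
  \<comment> \<open>Adding \<open>(a - 2) * b * k\<close> completes the square; then
    \<open>a^3 - 5 = (a^3 - 8) + 3\<close>.\<close>
  have sq: "(b - k)\<^sup>2 = (a - 2) * (b * k + a\<^sup>2 + 2 * a + 4) + 3"
    using eq by (simp add: algebra_simps power2_eq_square power3_eq_cube)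
  show False
  proof (cases "3 dvd a - 2")
    case False
    have "a - 2 dvd (b - k)\<^sup>2 - 3" by (simp add: sq)
    moreover have "odd (a - 2)" using a4 by presburger
    ultimately have "(a - 2) mod 12 = 1 \<or> (a - 2) mod 12 = 11"
      using divisor_square_minus_3_mod_12[of "a - 2" "b - k"] False by simp
    \<comment> \<open>Since \<open>a - 2\<close> is 3 modulo 4, only the residue 11
      survives.\<close>
    with a4 have "a mod 3 = 1" by presburger
    then obtain q where q: "a = 3 * q + 1" by (metis mult_div_mod_eq)
    \<comment> \<open>For \<open>a\<close> \<equiv> 1 modulo 3,
      \<open>b\<^sup>2 - a * b * k + k\<^sup>2\<close> is congruent to
      \<open>(b + k)\<^sup>2\<close>.\<close>
    have "(b + k)\<^sup>2 = 3 * (b * k + q * b * k + 9 * q^3 + 9 * q\<^sup>2 + 3 * q - 2) + 2"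
      using eq by (simp add: q algebra_simps power2_eq_square power3_eq_cube)
    then have "(b + k)\<^sup>2 mod 3 = 2" by presburger
    moreover have "(b + k) mod 3 = 0 \<or> (b + k) mod 3 = 1 \<or> (b + k) mod 3 = 2" by presburger
    ultimately show False using power_mod[of "b + k" 3 2] by auto
  next
    case True
    then obtain m where m: "a - 2 = 3 * m" by (auto elim: dvdE)
    have "3 dvd (b - k)\<^sup>2" by (simp add: sq m)
    then have "3 dvd b - k" using prime_dvd_power[of "3 :: int" "b - k" 2] by simp
    then obtain n where n: "b = k + 3 * n" by (metis add.commute diff_add_cancel dvdE)
    have a: "a = 3 * m + 2" using m by simp
    \<comment> \<open>Modulo 3, \<open>a\<close> \<equiv> 2 and \<open>b\<close> \<equiv>
      \<open>k\<close> turn the cofactor into \<open>k\<^sup>2\<close>; dividing by 3 leaves a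
      congruence for \<open>m\<close>.\<close>
    have "9 * n\<^sup>2 = 3 * m * (b * k + a\<^sup>2 + 2 * a + 4) + 3"
      using sq by (simp add: n m power2_eq_square)
    also have "\<dots> = 3 * (m * k\<^sup>2 + 1 + 3 * m * (n * k + 3 * m\<^sup>2 + 6 * m + 4))"
      by (simp add: n a algebra_simps power2_eq_square)
    finally have "m * k\<^sup>2 + 1 = 3 * (n\<^sup>2 - m * (n * k + 3 * m\<^sup>2 + 6 * m + 4))"
      by (simp add: algebra_simps)
    then have "(m * k\<^sup>2 + 1) mod 3 = 0" by simp
    moreover have "((m mod 3) * (k mod 3)\<^sup>2 + 1) mod 3 = (m * k\<^sup>2 + 1) mod 3"
      by (intro mod_add_cong mod_mult_cong power_mod mod_mod_trivial refl)
    ultimately have "((m mod 3) * (k mod 3)\<^sup>2 + 1) mod 3 = 0" by simp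
    moreover have "k mod 3 = 0 \<or> k mod 3 = 1 \<or> k mod 3 = 2" by presburger
    \<comment> \<open>The case \<open>k\<close> \<equiv> 0 would give 1 \<equiv> 0; the factors 1
      and 4 are the squares of the other residues.\<close>
    ultimately have "((m mod 3) + 1) mod 3 = 0 \<or> (m mod 3 * 4 + 1) mod 3 = 0" by auto
    then have m3: "m mod 3 = 2" by presburger
    have "m dvd (b - k)\<^sup>2 - 3" by (simp add: sq m)
    moreover have "odd m" "\<not> 3 dvd m" using a4 a m3 by presburger+
    ultimately have "m mod 12 = 1 \<or> m mod 12 = 11"
      using divisor_square_minus_3_mod_12[of m "b - k"] by simp
    \<comment> \<open>This excludes 11, and the residue 1 contradicts \<open>m3\<close>.\<close>
    moreover have "m mod 4 = 1" using a4 a by presburger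
    ultimately show False using m3 by presburger
  qed
qed

theorem theorem1p2:
  fixes k :: int
  shows "integral_points (E k) = {}"
  using E_no_integral_solution integral_points_E_iff by fast

end
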